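(* Let $\alpha \in \mathbb{R}_{>0}$ and $\mathbb{N}_0[\alpha] = \{f(\alpha) : f(X) \in \mathbb{N}_0[X]\}$ as an additive monoid. The following are equivalent: (a) $\mathbb{N}_0[\alpha]$ is atomic; (b) $\mathbb{N}_0[\alpha]$ is not antimatter; (c) $1 \in \mathcal{A}(\mathbb{N}_0[\alpha])$. In addition, if $\mathbb{N}_0[\alpha]$ is atomic, then: (1) if $\alpha$ is transcendental, then $\mathcal{A}(\mathbb{N}_0[\alpha]) = \{\alpha^n : n \in \mathbb{N}_0\}$; (2) if $\alpha$ is algebraic and $\sigma := \min\{n \in \mathbb{N} : \alpha^n \in \langle \alpha^j : 0 \le j \le n-1\rangle\}$ (with $\sigma=\infty$ if this set is empty), then if $\sigma<\infty$ we have $\mathcal{A}(\mathbb{N}_0[\alpha]) = \{\alpha^n : 0 \le n \le \sigma-1\}$, and if $\sigma=\infty$ we have $\mathcal{A}(\mathbb{N}_0[\alpha]) = \{\alpha^n : n \in \mathbb{N}_0\}$.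
   Context: Monoids are commutative, cancellative, additively written; $\mathbb{N}_0[\alpha]$ is reduced. An atom of $M$ is a nonzero $a\in M$ such that $a=x+y$ with $x,y\in M$ implies $x=0$ or $y=0$; $\mathcal{A}(M)$ denotes the set of atoms; $M$ is atomic if it is generated (as a monoid) by $\mathcal{A}(M)$, and antimatter if $\mathcal{A}(M)=\emptyset$. For a subset $S$, $\langle S\rangle$ is the submonoid generated by $S$; $\mathbb{N}=\{1,2,\dots\}$, $\mathbb{N}_0=\mathbb{N}\cup\{0\}$. *)

theory Defs
  imports
    Complex_Main
    "HOL-Computational_Algebra.Polynomial"
    "HOL-Library.Extended_Nat"
begin

(* Additive monoids are represented as subsets M of an ambient commutative monoid type,
   with the inherited 0 and +. *)

inductive_set submonoid_gen :: "'a::comm_monoid_add set \<Rightarrow> 'a set"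
  for S :: "'a set" where
    zero: "0 \<in> submonoid_gen S"
  | incl: "x \<in> S \<Longrightarrow> x \<in> submonoid_gen S"
  | add: "x \<in> submonoid_gen S \<Longrightarrow> y \<in> submonoid_gen S \<Longrightarrow> x + y \<in> submonoid_gen S"

(* Atoms in the sense appropriate for reduced monoids: 0 is the only unit. *)
definition monoid_atoms :: "'a::comm_monoid_add set \<Rightarrow> 'a set" where
  "monoid_atoms M =
     {a \<in> M. a \<noteq> 0 \<and> (\<forall>x\<in>M. \<forall>y\<in>M. a = x + y \<longrightarrow> x = 0 \<or> y = 0)}"

definition atomic_monoid :: "'a::comm_monoid_add set \<Rightarrow> bool" where
  "atomic_monoid M \<longleftrightarrow> submonoid_gen (monoid_atoms M) = M"

definition antimatter_monoid :: "'a::comm_monoid_add set \<Rightarrow> bool" where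
  "antimatter_monoid M \<longleftrightarrow> monoid_atoms M = {}"

definition nat_poly_values :: "real \<Rightarrow> real set" where
  "nat_poly_values \<alpha> = {poly (map_poly of_nat f) \<alpha> | f :: nat poly. True}"

definition in_lower_span :: "real \<Rightarrow> nat \<Rightarrow> bool" where
  "in_lower_span \<alpha> n \<longleftrightarrow> \<alpha> ^ n \<in> submonoid_gen {\<alpha> ^ j | j. 0 \<le> j \<and> j \<le> n - 1}"

(* The bound n - 1 in in_lower_span is truncated at n = 0; it is only used for n \<ge> 1. *)
definition sigma :: "real \<Rightarrow> enat" where
  "sigma \<alpha> =
     (if \<exists>n\<ge>1. in_lower_span \<alpha> n
      then enat (LEAST n. n \<ge> 1 \<and> in_lower_span \<alpha> n)
      else \<infinity>)"

end

theory Submission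
  imports Defs
begin

text \<open>
  An atom of a monoid lies in every generating set, so the atoms of $M = \mathbb{N}_0[\alpha]$ are
  powers of $\alpha$, and if $\alpha^n$ is an atom then so is $\alpha^m$ for all $m \le n$, because
  $M$ is closed under multiplication by $\alpha^{n-m}$. Suppose now that 1 is an atom and that
  $\alpha^n = x + y$ with $x, y \in M$ positive. If $\alpha < 1$, then $x, y < \alpha^n$ forces
  $x, y \in \alpha^n M$, and dividing by $\alpha^n$ contradicts that 1 is an atom; so every power is
  an atom. If $\alpha \ge 1$, then $x$ and $y$ are sums of powers smaller than $\alpha^n$, so
  $\alpha^n$ lies in the span of the lower powers; by induction every power is a sum of atoms, and
  the first power that is not an atom is $\alpha^\sigma$ (unless $\alpha = 1$, where all powers
  coincide).
\<close>

section \<open>Generated submonoids and their atoms\<close>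

lemma submonoid_gen_subset:
  assumes "S \<subseteq> submonoid_gen T"
  shows "submonoid_gen S \<subseteq> submonoid_gen T"
proof
  fix x assume "x \<in> submonoid_gen S"
  then show "x \<in> submonoid_gen T"
    by induction (use assms in \<open>auto intro: submonoid_gen.intros\<close>)
qed

lemma submonoid_gen_of_nat:
  assumes "(1 :: 'a::semiring_1) \<in> submonoid_gen S"
  shows "of_nat k \<in> submonoid_gen S"
  by (induction k) (use assms in \<open>auto intro: submonoid_gen.intros\<close>)

text \<open>When a sum is an atom, one summand vanishes, so the atom equals the other summand and
  the induction hypothesis applies to it.\<close>

lemma monoid_atoms_submonoid_gen:
  "monoid_atoms (submonoid_gen S) \<subseteq> S"
proof
  fix a assume "a \<in> monoid_atoms (submonoid_gen S)"
  then have a: "a \<noteq> 0" "\<And>x y. x \<in> submonoid_gen S \<Longrightarrow> y \<in> submonoid_gen S \<Longrightarrow> a = x + y \<Longrightarrow> x = 0 \<or> y = 0"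
    and "a \<in> submonoid_gen S"
    by (auto simp: monoid_atoms_def)
  \<comment> \<open>The atom properties are chained in so that the induction carries them for each
    element.\<close>
  from this(3) this(1,2) show "a \<in> S"
  proof induction
    case (add x y)
    then consider "x = 0" | "y = 0" by blast
    then show ?case
      using add by cases simp_all
  qed auto
qed

lemma submonoid_gen_empty: "submonoid_gen {} = {0 :: 'a::comm_monoid_add}"
proof -
  have "x = 0" if "x \<in> submonoid_gen {}" for x :: 'a
    using that by induction auto
  then show ?thesis by (auto intro: submonoid_gen.zero)
qed

section \<open>Polynomial values, lower spans and algebraicity\<close>

lemma mult_power_submonoid_gen:
  fixes \<alpha> :: real
  assumes "x \<in> submonoid_gen (range ((^) \<alpha>))"
  shows "\<alpha> ^ k * x \<in> submonoid_gen (range ((^) \<alpha>))"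
  using assms
  by induction (auto simp: distrib_left simp flip: power_add intro: submonoid_gen.intros)

text \<open>Trades coefficients for rule induction over sums of powers. One inclusion follows
  Horner's scheme, the other builds polynomials from monomials.\<close>

lemma nat_poly_values_eq: "nat_poly_values \<alpha> = submonoid_gen (range ((^) \<alpha>))"
proof (intro equalityI subsetI)
  fix x assume "x \<in> nat_poly_values \<alpha>"
  then obtain f :: "nat poly" where "x = poly (map_poly of_nat f) \<alpha>"
    by (auto simp: nat_poly_values_def)
  moreover have "poly (map_poly of_nat f) \<alpha> \<in> submonoid_gen (range ((^) \<alpha>))"
  proof (induction f)
    case 0
    show ?case by (simp add: submonoid_gen.zero)
  next
    case (pCons a f)
    have "1 \<in> submonoid_gen (range ((^) \<alpha>))"
      by (rule submonoid_gen.incl) (metis power_0 rangeI)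
    then show ?case
      using pCons mult_power_submonoid_gen[OF pCons.IH, of 1]
      by (auto simp: map_poly_pCons intro: submonoid_gen.add submonoid_gen_of_nat)
  qed
  ultimately show "x \<in> submonoid_gen (range ((^) \<alpha>))" by simp
next
  fix x assume "x \<in> submonoid_gen (range ((^) \<alpha>))"
  then have "\<exists>f :: nat poly. x = poly (map_poly of_nat f) \<alpha>"
  proof induction
    case zero
    show ?case by (rule exI[of _ 0]) simp
  next
    case (incl x)
    then obtain n where "x = \<alpha> ^ n" by auto
    then show ?case
      by (intro exI[of _ "monom 1 n"]) (simp add: map_poly_monom poly_monom)
  next
    case (add x y)
    then obtain f g :: "nat poly"
      where "x = poly (map_poly of_nat f) \<alpha>" "y = poly (map_poly of_nat g) \<alpha>" by blast
    moreover have "map_poly real (f + g) = map_poly real f + map_poly real g"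
      by (intro poly_eqI) (simp add: coeff_map_poly)
    ultimately show ?case
      by (intro exI[of _ "f + g"]) simp
  qed
  then show "x \<in> nat_poly_values \<alpha>" by (auto simp: nat_poly_values_def)
qed

text \<open>For positive \<open>n\<close> the truncated subtraction is harmless, and the strict
  bound suits comparison of powers.\<close>

lemma in_lower_span_iff:
  assumes "n \<ge> 1"
  shows "in_lower_span \<alpha> n \<longleftrightarrow> \<alpha> ^ n \<in> submonoid_gen ((^) \<alpha> ` {..<n})"
proof -
  have "{\<alpha> ^ j | j. 0 \<le> j \<and> j \<le> n - 1} = (^) \<alpha> ` {..<n}"
    using assms by auto
  then show ?thesis by (simp add: in_lower_span_def)
qed

text \<open>An element of the lower span is the value of an integer polynomial of degree below
  \<open>n\<close>; subtracting that polynomial from the monomial of degree \<open>n\<close> leaves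
  a monic one that vanishes at \<alpha>.\<close>

lemma in_lower_span_imp_algebraic:
  assumes "n \<ge> 1" and "in_lower_span \<alpha> n"
  shows "algebraic \<alpha>"
proof -
  have "\<alpha> ^ n \<in> submonoid_gen ((^) \<alpha> ` {..<n})"
    using assms by (simp add: in_lower_span_iff)
  moreover have "\<exists>p. (\<forall>i. coeff p i \<in> \<int>) \<and> degree p < n \<and> poly p \<alpha> = x"
    if "x \<in> submonoid_gen ((^) \<alpha> ` {..<n})" for x
    using that
  proof induction
    case zero
    show ?case by (rule exI[of _ 0]) (use assms in auto)
  next
    case (incl x)
    then obtain j where "j < n" "x = \<alpha> ^ j" by auto
    then show ?case
      by (intro exI[of _ "monom 1 j"]) (auto simp: poly_monom degree_monom_eq)
  next
    case (add x y)
    then obtain p q where "\<forall>i. coeff p i \<in> \<int>" "degree p < n" "poly p \<alpha> = x"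
      "\<forall>i. coeff q i \<in> \<int>" "degree q < n" "poly q \<alpha> = y" by blast
    then show ?case
      by (intro exI[of _ "p + q"]) (auto simp: degree_add_less)
  qed
  ultimately obtain p where p: "\<forall>i. coeff p i \<in> \<int>" "degree p < n" "poly p \<alpha> = \<alpha> ^ n"
    by blast
  show ?thesis
  proof (rule algebraicI)
    show "coeff (monom 1 n - p) i \<in> \<int>" for i using p by simp
    have "coeff (monom 1 n - p) n = 1" using p(2) by (simp add: coeff_eq_0)
    then show "monom 1 n - p \<noteq> 0" by (metis coeff_0 zero_neq_one)
    show "poly (monom 1 n - p) \<alpha> = 0" using p(3) by (simp add: poly_monom)
  qed
qed

section \<open>Atoms of the monoid generated by the powers of a fixed positive \<alpha>\<close>

context
  fixes \<alpha> :: real and M :: "real set"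
  assumes pos: "\<alpha> > 0"
  defines "M \<equiv> submonoid_gen (range ((^) \<alpha>))"
begin

lemma nonneg: "x \<in> M \<Longrightarrow> x \<ge> 0"
  unfolding M_def by (induction rule: submonoid_gen.induct) (use pos in auto)

lemma power_in: "\<alpha> ^ n \<in> M"
  unfolding M_def by (auto intro: submonoid_gen.incl)

lemma atom_is_power: "a \<in> monoid_atoms M \<Longrightarrow> \<exists>n. a = \<alpha> ^ n"
  using monoid_atoms_submonoid_gen[of "range ((^) \<alpha>)"] by (auto simp: M_def)

lemma atom_power_mono:
  assumes "\<alpha> ^ n \<in> monoid_atoms M" and "m \<le> n"
  shows "\<alpha> ^ m \<in> monoid_atoms M"
proof -
  have "x = 0 \<or> y = 0" if "x \<in> M" "y \<in> M" "\<alpha> ^ m = x + y" for x y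
  proof -
    have "\<alpha> ^ n = \<alpha> ^ (n - m) * \<alpha> ^ m"
      using assms(2) by (simp flip: power_add)
    then have "\<alpha> ^ n = \<alpha> ^ (n - m) * x + \<alpha> ^ (n - m) * y"
      using that(3) by (simp add: distrib_left)
    moreover have "\<alpha> ^ (n - m) * x \<in> M" "\<alpha> ^ (n - m) * y \<in> M"
      using that mult_power_submonoid_gen by (auto simp: M_def)
    ultimately have "\<alpha> ^ (n - m) * x = 0 \<or> \<alpha> ^ (n - m) * y = 0"
      using assms(1) unfolding monoid_atoms_def by blast
    then show ?thesis using pos by simp
  qed
  then show ?thesis using pos power_in by (auto simp: monoid_atoms_def)
qed

text \<open>Summands of \<open>x\<close> are nonnegative, hence also below
  \<open>\<alpha> ^ n\<close>, and for \<alpha> < 1 the powers below \<open>\<alpha> ^ n\<close> are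
  those with exponent above \<open>n\<close>.\<close>

lemma less_power_dvd:
  assumes "\<alpha> < 1" and "x \<in> M" and "x < \<alpha> ^ n"
  shows "\<exists>z\<in>M. x = \<alpha> ^ n * z"
  using assms(2,3) unfolding M_def
proof induction
  case zero
  show ?case by (auto intro: submonoid_gen.zero)
next
  case (incl x)
  then obtain j where j: "x = \<alpha> ^ j" by auto
  with incl have "n < j"
    using pos \<open>\<alpha> < 1\<close> by (simp add: power_strict_decreasing_iff)
  with j have "x = \<alpha> ^ n * \<alpha> ^ (j - n)" by (simp flip: power_add)
  then show ?case using power_in by (auto simp: M_def)
next
  case (add x y)
  then have "x \<ge> 0" "y \<ge> 0" using nonneg by (auto simp: M_def)
  with add.prems have "x < \<alpha> ^ n" "y < \<alpha> ^ n" by linarith+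
  with add.IH obtain z w where "z \<in> submonoid_gen (range ((^) \<alpha>))" "x = \<alpha> ^ n * z"
    "w \<in> submonoid_gen (range ((^) \<alpha>))" "y = \<alpha> ^ n * w" by blast
  then show ?case by (intro bexI[of _ "z + w"]) (auto simp: distrib_left intro: submonoid_gen.add)
qed

text \<open>Counterpart for \<alpha> \<ge> 1, where a power below \<open>\<alpha> ^ n\<close> must
  have a smaller exponent.\<close>

lemma less_power_lower_span:
  assumes "\<alpha> \<ge> 1" and "x \<in> M" and "x < \<alpha> ^ n"
  shows "x \<in> submonoid_gen ((^) \<alpha> ` {..<n})"
  using assms(2,3) unfolding M_def
proof induction
  case zero
  show ?case by (rule submonoid_gen.zero)
next
  case (incl x)
  then obtain j where j: "x = \<alpha> ^ j" by auto
  with incl have "j < n"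
    using power_increasing[OF _ \<open>\<alpha> \<ge> 1\<close>, of n j] by (meson not_le)
  with j show ?case by (auto intro: submonoid_gen.incl)
next
  case (add x y)
  then have "x \<ge> 0" "y \<ge> 0" using nonneg by (auto simp: M_def)
  with add show ?case by (intro submonoid_gen.add) auto
qed

text \<open>Drives both atomicity and the description of the atoms: a power that fails to be an atom
  is a candidate in the minimum defining \<open>sigma\<close>.\<close>

lemma not_atom_in_lower_span:
  assumes one: "1 \<in> monoid_atoms M" and "\<alpha> ^ n \<notin> monoid_atoms M"
  shows "n \<ge> 1 \<and> in_lower_span \<alpha> n"
proof -
  have "n \<ge> 1"
  proof (rule ccontr)
    assume "\<not> n \<ge> 1"
    then have "n = 0" by simp
    with assms show False by simp
  qed
  obtain x y where xy: "x \<in> M" "y \<in> M" "\<alpha> ^ n = x + y" "x \<noteq> 0" "y \<noteq> 0"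
    using assms(2) power_in pos by (auto simp: monoid_atoms_def)
  then have less: "x < \<alpha> ^ n" "y < \<alpha> ^ n"
    using nonneg[of x] nonneg[of y] by auto
  \<comment> \<open>For \<alpha> < 1 both summands are divisible by \<open>\<alpha> ^ n\<close>
    within \<open>M\<close>, so the splitting would descend to a splitting of 1.\<close>
  have "\<alpha> \<ge> 1"
  proof (rule ccontr)
    assume "\<not> \<alpha> \<ge> 1"
    then have "\<alpha> < 1" by simp
    from less_power_dvd[OF this xy(1) less(1)] less_power_dvd[OF this xy(2) less(2)]
    obtain z w where zw: "z \<in> M" "w \<in> M" "x = \<alpha> ^ n * z" "y = \<alpha> ^ n * w" by blast
    with xy(3) have "\<alpha> ^ n * 1 = \<alpha> ^ n * (z + w)" by (simp add: distrib_left)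
    then have "1 = z + w" using pos by simp
    with one zw have "z = 0 \<or> w = 0" unfolding monoid_atoms_def by blast
    with xy(4,5) zw(3,4) show False by (metis mult_zero_right)
  qed
  then have "\<alpha> ^ n \<in> submonoid_gen ((^) \<alpha> ` {..<n})"
    unfolding xy(3)
    using xy(1,2) less by (intro submonoid_gen.add less_power_lower_span)
  with \<open>n \<ge> 1\<close> show ?thesis by (simp add: in_lower_span_iff)
qed

lemma one_atom_imp_atomic:
  assumes "1 \<in> monoid_atoms M"
  shows "atomic_monoid M"
proof -
  have "\<alpha> ^ n \<in> submonoid_gen (monoid_atoms M)" for n
  proof (induction n rule: less_induct)
    case (less n)
    show ?case
    proof (cases "\<alpha> ^ n \<in> monoid_atoms M")
      case True
      then show ?thesis by (rule submonoid_gen.incl)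
    next
      case False
      then have "\<alpha> ^ n \<in> submonoid_gen ((^) \<alpha> ` {..<n})"
        using not_atom_in_lower_span[OF assms] in_lower_span_iff by blast
      with less submonoid_gen_subset[of "(^) \<alpha> ` {..<n}" "monoid_atoms M"]
      show ?thesis by blast
    qed
  qed
  then have "M \<subseteq> submonoid_gen (monoid_atoms M)"
    unfolding M_def by (intro submonoid_gen_subset) auto
  moreover have "submonoid_gen (monoid_atoms M) \<subseteq> M"
    unfolding M_def
    by (intro submonoid_gen_subset) (auto simp: monoid_atoms_def)
  ultimately show ?thesis by (simp add: atomic_monoid_def)
qed

lemma atomic_imp_not_antimatter:
  assumes "atomic_monoid M"
  shows "\<not> antimatter_monoid M"
proof
  assume "antimatter_monoid M"
  with assms have "M = {0}"
    by (simp add: atomic_monoid_def antimatter_monoid_def submonoid_gen_empty)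
  with power_in[of 0] show False by simp
qed

text \<open>Any atom is a power of \<alpha>, and being an atom passes down to exponent 0.\<close>

lemma not_antimatter_iff: "\<not> antimatter_monoid M \<longleftrightarrow> 1 \<in> monoid_atoms M"
proof
  assume "\<not> antimatter_monoid M"
  then obtain n where "\<alpha> ^ n \<in> monoid_atoms M"
    using atom_is_power by (fastforce simp: antimatter_monoid_def)
  from atom_power_mono[OF this, of 0] show "1 \<in> monoid_atoms M" by simp
qed (auto simp: antimatter_monoid_def)

lemma atoms_sigma_infinite:
  assumes "1 \<in> monoid_atoms M" and "sigma \<alpha> = \<infinity>"
  shows "monoid_atoms M = {\<alpha> ^ n | n :: nat. True}"
proof -
  have "\<alpha> ^ n \<in> monoid_atoms M" for n
    using not_atom_in_lower_span[OF assms(1), of n] assms(2)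
    by (auto simp: sigma_def split: if_splits)
  then show ?thesis using atom_is_power by blast
qed

lemma atoms_sigma_finite:
  assumes "1 \<in> monoid_atoms M" and "sigma \<alpha> = enat s"
  shows "monoid_atoms M = {\<alpha> ^ n | n. 0 \<le> n \<and> n \<le> s - 1}"
proof -
  have ex: "\<exists>n\<ge>1. in_lower_span \<alpha> n" and s: "s = (LEAST n. n \<ge> 1 \<and> in_lower_span \<alpha> n)"
    using assms(2) by (auto simp: sigma_def split: if_splits)
  have "s \<ge> 1" and span: "in_lower_span \<alpha> s"
    using LeastI_ex[of "\<lambda>n. n \<ge> 1 \<and> in_lower_span \<alpha> n"] ex s by auto
  have least: "s \<le> n" if "n \<ge> 1" "in_lower_span \<alpha> n" for n
    unfolding s using that by (intro Least_le) auto
  have "\<alpha> ^ n \<in> monoid_atoms M" if "n \<le> s - 1" for n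
    using not_atom_in_lower_span[OF assms(1), of n] least[of n] that by fastforce
  moreover have "\<exists>k\<le>s - 1. \<alpha> ^ n = \<alpha> ^ k" if n: "\<alpha> ^ n \<in> monoid_atoms M" for n
  proof (cases "n < s")
    case True
    then show ?thesis by (intro exI[of _ n]) auto
  next
    case False
    let ?L = "submonoid_gen ((^) \<alpha> ` {..<s})"
    have "\<alpha> ^ s \<in> monoid_atoms M"
      using atom_power_mono[OF n] False by simp
    moreover have "?L \<subseteq> M"
      unfolding M_def by (intro submonoid_gen_subset) (auto intro: submonoid_gen.incl)
    moreover have "\<alpha> ^ s \<in> ?L"
      using span \<open>s \<ge> 1\<close> by (simp add: in_lower_span_iff)
    \<comment> \<open>An atom of \<open>M\<close> lying in the submonoid \<open>?L\<close> has even
      fewer splittings there, so it stays an atom and must be one of the generators of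
      \<open>?L\<close>.\<close>
    ultimately have "\<alpha> ^ s \<in> monoid_atoms ?L"
      by (auto simp: monoid_atoms_def)
    then obtain j where j: "j < s" "\<alpha> ^ s = \<alpha> ^ j"
      using monoid_atoms_submonoid_gen by blast
    \<comment> \<open>Equal powers with distinct exponents force this degenerate case, in which any
      \<open>k\<close> gives the same power.\<close>
    have "\<alpha> = 1"
      using j pos power_inject_exp'[of \<alpha> s j] by auto
    then show ?thesis by auto
  qed
  ultimately show ?thesis
  proof (intro equalityI subsetI)
    fix a assume atoms: "\<And>n. \<alpha> ^ n \<in> monoid_atoms M \<Longrightarrow> \<exists>k\<le>s - 1. \<alpha> ^ n = \<alpha> ^ k"
      and "a \<in> monoid_atoms M"
    with atom_is_power obtain n where "a = \<alpha> ^ n" "\<alpha> ^ n \<in> monoid_atoms M" by blast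
    with atoms[of n] show "a \<in> {\<alpha> ^ n | n. 0 \<le> n \<and> n \<le> s - 1}" by auto
  qed auto
qed

end

theorem theorem4p1:
  fixes \<alpha> :: real
  assumes "\<alpha> > 0"
  shows "(atomic_monoid (nat_poly_values \<alpha>) \<longleftrightarrow> \<not> antimatter_monoid (nat_poly_values \<alpha>))
    \<and> (\<not> antimatter_monoid (nat_poly_values \<alpha>) \<longleftrightarrow> 1 \<in> monoid_atoms (nat_poly_values \<alpha>))
    \<and> (atomic_monoid (nat_poly_values \<alpha>) \<longrightarrow>
         (\<not> algebraic \<alpha> \<longrightarrow> monoid_atoms (nat_poly_values \<alpha>) = {\<alpha> ^ n | n :: nat. True})
       \<and> (algebraic \<alpha> \<longrightarrow>
            (\<forall>s. sigma \<alpha> = enat s \<longrightarrow>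
                 monoid_atoms (nat_poly_values \<alpha>) = {\<alpha> ^ n | n. 0 \<le> n \<and> n \<le> s - 1})
          \<and> (sigma \<alpha> = \<infinity> \<longrightarrow>
                 monoid_atoms (nat_poly_values \<alpha>) = {\<alpha> ^ n | n :: nat. True})))"
proof -
  \<comment> \<open>The transcendental case thus becomes an instance of infinite
    \<open>sigma\<close>.\<close>
  have "sigma \<alpha> = \<infinity>" if "\<not> algebraic \<alpha>"
    using that in_lower_span_imp_algebraic by (auto simp: sigma_def)
  then show ?thesis
    unfolding nat_poly_values_eq not_antimatter_iff[OF assms]
    using one_atom_imp_atomic[OF assms] atoms_sigma_infinite[OF assms]
      atoms_sigma_finite[OF assms]
      atomic_imp_not_antimatter[OF assms, unfolded not_antimatter_iff[OF assms]]
    by (intro conjI impI iffI allI) simp_all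
qed

end
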